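(* Let $\mathcal{E}=(E;+,q,d,0,1)$ be a q-effect algebra such that the set $S=\{s:E\to[0,1]\mid s \text{ is a q-state on } \mathcal{E}\}$ of all q-states on $\mathcal{E}$ is order reflecting. Let $t:E\to[0,1]$ be a Jauch-Piron q-semi-state on $\mathcal{E}$ and let $S_t=\{s\in S\mid s\geq t\}$ (pointwise order). Then $t=\bigwedge S_t$, i.e. $t(x)=\inf\{s(x)\mid s\in S_t\}$ for every $x\in E$ (infimum taken in $[0,1]$, the empty infimum being $1$).
   Context: An effect algebra is a structure $(E;+,0,1)$ with distinguished elements $0\neq 1$ of $E$ and a partial binary operation $+$ such that for $x,y,z\in E$: (E1) if $x+y$ is defined then $y+x$ is defined and $x+y=y+x$; (E2) if $y+z$ and $x+(y+z)$ are defined then $x+y$ and $(x+y)+z$ are defined and $(x+y)+z=x+(y+z)$; (E3) for each $x$ there is a unique $x'\in E$ with $x+x'=1$; (E4) if $x+1$ is defined then $x=0$. The induced order is $x\leq y$ iff $x+z=y$ for some $z\in E$; it is a partial order with bottom $0$ and top $1$, and $x+y$ is defined iff $x\leq y'$. The dual partial operation: $x\cdot y$ is defined iff $x'\leq y$, and then $x\cdot y=(x'+y')'$. A q-effect algebra $(E;+,q,d,0,1)$ is an effect algebra with maps $q,d:E\to E$ such that for all $x,y,z\in E$: (Q1) $d(x')=q(x)'$; (Q2) $d(0)=0=q(0)$; (Q3) $d$ is order-preserving; (Q4) $x'\leq x$ implies $x\cdot x=d(x)$; (Q5) $z\leq x$, $z\leq y$ and $y'\leq x$ imply $d(z)\leq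 x\cdot y$. On $[0,1]$ put $a\oplus b=\min(1,a+b)$ and $a\odot b=\max(0,a+b-1)$. A q-state on $\mathcal{E}$ is a map $s:E\to[0,1]$ with $s(0)=0$, $s(1)=1$, $s(x+y)=s(x)+s(y)$ whenever $x+y$ is defined, $s(q(x))=s(x)\oplus s(x)$ and $s(d(x))=s(x)\odot s(x)$ for all $x\in E$. A q-semi-state on $\mathcal{E}$ is a map $s:E\to[0,1]$ with (i) $s(1)=1$; (ii) $s(x)\leq s(y)$ whenever $x\leq y$; (iii) $s(x)\odot s(x)=s(d(x))$; (iv) $s(x)\oplus s(x)=s(q(x))$. It is a Jauch-Piron q-semi-state if moreover (v) $s(x)=1=s(y)$ implies $s(z)=1$ for some $z\in E$ with $z\leq x$ and $z\leq y$. A set $S$ of q-states on $\mathcal{E}$ is order reflecting if for all $a,b\in E$: ($s(a)\leq s(b)$ for all $s\in S$) implies $a\leq b$. *)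

theory Defs
  imports Complex_Main
begin

text \<open>
  The underlying set of an effect algebra is the whole (arbitrary) type \<open>'a\<close>;
  \<open>padd x y = None\<close> means that \<open>x + y\<close> is undefined.
\<close>

locale effect_algebra =
  fixes padd :: "'a \<Rightarrow> 'a \<Rightarrow> 'a option"
    and zero :: 'a
    and one :: 'a
  assumes zero_neq_one: "zero \<noteq> one"
    and E1: "padd x y = Some z \<Longrightarrow> padd y x = Some z"
    and E2: "padd y z = Some u \<Longrightarrow> padd x u = Some v \<Longrightarrow>
               \<exists>w. padd x y = Some w \<and> padd w z = Some v"
    and E3: "\<exists>!y. padd x y = Some one"
    and E4: "padd x one \<noteq> None \<Longrightarrow> x = zero"
begin

definition le :: "'a \<Rightarrow> 'a \<Rightarrow> bool"  (infix "\<sqsubseteq>" 50)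
  where "x \<sqsubseteq> y \<longleftrightarrow> (\<exists>z. padd x z = Some y)"

definition compl :: "'a \<Rightarrow> 'a"
  where "compl x = (THE y. padd x y = Some one)"

definition pmult :: "'a \<Rightarrow> 'a \<Rightarrow> 'a option"
  where "pmult x y =
    (if compl x \<sqsubseteq> y then map_option compl (padd (compl x) (compl y)) else None)"

end

locale q_effect_algebra = effect_algebra padd zero one
  for padd :: "'a \<Rightarrow> 'a \<Rightarrow> 'a option" and zero :: 'a and one :: 'a +
  fixes q :: "'a \<Rightarrow> 'a"
    and d :: "'a \<Rightarrow> 'a"
  assumes Q1: "d (compl x) = compl (q x)"
    and Q2: "d zero = zero" "q zero = zero"
    and Q3: "x \<sqsubseteq> y \<Longrightarrow> d x \<sqsubseteq> d y"
    and Q4: "compl x \<sqsubseteq> x \<Longrightarrow> pmult x x = Some (d x)"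
    and Q5: "z \<sqsubseteq> x \<Longrightarrow> z \<sqsubseteq> y \<Longrightarrow> compl y \<sqsubseteq> x \<Longrightarrow>
               \<exists>w. pmult x y = Some w \<and> d z \<sqsubseteq> w"

definition trunc_add :: "real \<Rightarrow> real \<Rightarrow> real"
  where "trunc_add a b = min 1 (a + b)"

definition trunc_mult :: "real \<Rightarrow> real \<Rightarrow> real"
  where "trunc_mult a b = max 0 (a + b - 1)"

text \<open>
  Infimum in the complete lattice \<open>[0,1]\<close>, for \<open>A \<subseteq> {0..1}\<close>; the value of
  \<open>Inf {}\<close> in the reals is unspecified.
\<close>

definition unit_Inf :: "real set \<Rightarrow> real"
  where "unit_Inf A = (if A = {} then 1 else Inf A)"

context q_effect_algebra
begin

definition q_state :: "('a \<Rightarrow> real) \<Rightarrow> bool"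
  where "q_state s \<longleftrightarrow>
    (\<forall>x. s x \<in> {0..1}) \<and>
    s zero = 0 \<and> s one = 1 \<and>
    (\<forall>x y z. padd x y = Some z \<longrightarrow> s z = s x + s y) \<and>
    (\<forall>x. s (q x) = trunc_add (s x) (s x)) \<and>
    (\<forall>x. s (d x) = trunc_mult (s x) (s x))"

definition q_semi_state :: "('a \<Rightarrow> real) \<Rightarrow> bool"
  where "q_semi_state s \<longleftrightarrow>
    (\<forall>x. s x \<in> {0..1}) \<and>
    s one = 1 \<and>
    (\<forall>x y. x \<sqsubseteq> y \<longrightarrow> s x \<le> s y) \<and>
    (\<forall>x. trunc_mult (s x) (s x) = s (d x)) \<and>
    (\<forall>x. trunc_add (s x) (s x) = s (q x))"

definition Jauch_Piron_q_semi_state :: "('a \<Rightarrow> real) \<Rightarrow> bool"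
  where "Jauch_Piron_q_semi_state s \<longleftrightarrow>
    q_semi_state s \<and>
    (\<forall>x y. s x = 1 \<and> s y = 1 \<longrightarrow> (\<exists>z. s z = 1 \<and> z \<sqsubseteq> x \<and> z \<sqsubseteq> y))"

definition order_reflecting :: "('a \<Rightarrow> real) set \<Rightarrow> bool"
  where "order_reflecting S \<longleftrightarrow> (\<forall>a b. (\<forall>s\<in>S. s a \<le> s b) \<longrightarrow> a \<sqsubseteq> b)"

end

end

theory Submission
  imports Defs "HOL-Analysis.Function_Topology"
begin

text \<open>
  Both q-states and q-semi-states turn \<open>q\<close> and \<open>d\<close> into the truncated doubling maps
  \<open>a \<mapsto> min 1 (2a)\<close> and \<open>a \<mapsto> max 0 (2a - 1)\<close> of the unit interval. Compositions of these two
  maps separate any two reals \<open>u < v\<close> of \<open>[0,1]\<close>: one of them is \<open>1\<close> on \<open>[v,1]\<close> and less than \<open>1\<close>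
  on \<open>[0,u]\<close> (lemma \<open>separating_term\<close>). Such a map is therefore determined by the set
  where it equals \<open>1\<close>, and \<open>t \<le> s\<close> holds as soon as \<open>s\<close> is \<open>1\<close> on the set \<open>F = {y. t y = 1}\<close>
  (lemma \<open>le_if_one_on_unit_set\<close>).

  Given \<open>t x < r \<le> 1\<close>, it remains to find a q-state that is \<open>1\<close> on \<open>F\<close> and at most \<open>r\<close> at \<open>x\<close>;
  then \<open>t x\<close> is the infimum. The set \<open>S\<close> of q-states is compact in the product topology,
  and so is its part \<open>K\<close> cut out by \<open>s x \<le> r\<close>. Suppose that every \<open>s \<in> K\<close> is less than \<open>1\<close> somewhere
  on \<open>F\<close>. Since \<open>F\<close> is closed under \<open>d\<close>, and iterating \<open>d\<close> pushes any value below \<open>1\<close> down to \<open>0\<close>, the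
  open sets \<open>{s. s w < 1/2}\<close> with \<open>w \<in> F\<close> cover \<open>K\<close>. Finitely many suffice, and the
  Jauch-Piron property gives one \<open>z \<in> F\<close> below all of the finitely many \<open>w\<close>; so
  \<open>d z \<in> F\<close> vanishes under all \<open>s \<in> K\<close>. Now let \<open>f\<close> be a composition of \<open>q\<close> and \<open>d\<close> that separates \<open>t x\<close>
  from \<open>r\<close>. For each q-state \<open>s\<close>, either \<open>s (d z) = 0\<close> or \<open>s (f x) = 1\<close>, hence \<open>s (d z) \<le> s (f x)\<close>.
  Order reflection gives \<open>d z \<sqsubseteq> f x\<close>, so \<open>t (f x) = 1\<close>, which contradicts \<open>t x < r\<close>.
\<close>

section \<open>Separating reals by truncated doublings\<close>

definition truncated_doubling :: "('a \<Rightarrow> 'a) \<Rightarrow> ('a \<Rightarrow> 'a) \<Rightarrow> ('a \<Rightarrow> real) \<Rightarrow> bool"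
  where "truncated_doubling q d h \<longleftrightarrow>
    (\<forall>x. h x \<in> {0..1}) \<and>
    (\<forall>x. h (q x) = trunc_add (h x) (h x)) \<and>
    (\<forall>x. h (d x) = trunc_mult (h x) (h x))"

text \<open>
  The term \<open>f\<close> depends on \<open>u\<close> and \<open>v\<close> only, so that the same \<open>f\<close> serves for states and
  semi-states. If \<open>u\<close> and \<open>v\<close> lie in the same half of the unit interval, then \<open>q\<close> (lower half) or
  \<open>d\<close> (upper half) doubles their distance; if \<open>1/2\<close> lies between them, then \<open>q\<close> separates them
  at once. As the distance cannot exceed \<open>1\<close>, this ends after finitely many steps.
\<close>

lemma separating_term:
  fixes q d :: "'a \<Rightarrow> 'a" and u v :: real
  assumes "0 \<le> u" "u < v" "v \<le> 1"
  shows "\<exists>f. \<forall>h x. truncated_doubling q d h \<longrightarrow>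
           (v \<le> h x \<longrightarrow> h (f x) = 1) \<and> (h x \<le> u \<longrightarrow> h (f x) < 1)"
proof -
  have gap: "\<exists>f. \<forall>h x. truncated_doubling q d h \<longrightarrow>
           (v \<le> h x \<longrightarrow> h (f x) = 1) \<and> (h x \<le> u \<longrightarrow> h (f x) < 1)"
    if "0 \<le> u" "u < v" "v \<le> 1" "1 \<le> 2 ^ n * (v - u)" for n and u v :: real
    using that
  proof (induction n arbitrary: u v)
    case 0
    then have "u = 0" "v = 1" by auto
    then show ?case
      by (intro exI[of _ id]) (auto simp: truncated_doubling_def intro: antisym)
  next
    case (Suc n)
    consider "v \<le> 1/2" | "1/2 \<le> u" | "u < 1/2" "1/2 < v" by linarith
    then show ?case
    proof cases
      case 1
      with Suc.prems obtain f where f: "\<forall>h x. truncated_doubling q d h \<longrightarrow>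
          (2 * v \<le> h x \<longrightarrow> h (f x) = 1) \<and> (h x \<le> 2 * u \<longrightarrow> h (f x) < 1)"
        using Suc.IH[of "2 * u" "2 * v"] by (auto simp: algebra_simps)
      have "(v \<le> h x \<longrightarrow> h (f (q x)) = 1) \<and> (h x \<le> u \<longrightarrow> h (f (q x)) < 1)"
        if h: "truncated_doubling q d h" for h x
      proof -
        have "h (q x) = min 1 (2 * h x)"
          using h by (simp add: truncated_doubling_def trunc_add_def)
        then show ?thesis using f[rule_format, OF h, of "q x"] 1 by (auto simp: min_def)
      qed
      then show ?thesis by (intro exI[of _ "f \<circ> q"]) simp
    next
      case 2
      with Suc.prems obtain f where f: "\<forall>h x. truncated_doubling q d h \<longrightarrow>
          (2 * v - 1 \<le> h x \<longrightarrow> h (f x) = 1) \<and> (h x \<le> 2 * u - 1 \<longrightarrow> h (f x) < 1)"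
        using Suc.IH[of "2 * u - 1" "2 * v - 1"] by (auto simp: algebra_simps)
      have "(v \<le> h x \<longrightarrow> h (f (d x)) = 1) \<and> (h x \<le> u \<longrightarrow> h (f (d x)) < 1)"
        if h: "truncated_doubling q d h" for h x
      proof -
        have "h (d x) = max 0 (2 * h x - 1)"
          using h by (simp add: truncated_doubling_def trunc_mult_def)
        then show ?thesis using f[rule_format, OF h, of "d x"] 2 by (auto simp: max_def)
      qed
      then show ?thesis by (intro exI[of _ "f \<circ> d"]) simp
    next
      case 3
      then show ?thesis
        by (intro exI[of _ q]) (auto simp: truncated_doubling_def trunc_add_def)
    qed
  qed
  obtain n where "1 / (v - u) < 2 ^ n"
    using real_arch_pow[of 2 "1 / (v - u)"] by auto
  then have "1 \<le> 2 ^ n * (v - u)"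
    using assms by (simp add: field_simps)
  with assms show ?thesis by (intro gap)
qed

text \<open>
  If \<open>s y < t y\<close> for some \<open>y\<close>, then a separating term \<open>f\<close> yields \<open>t (f y) = 1\<close> and \<open>s (f y) < 1\<close>.
\<close>

lemma le_if_one_on_unit_set:
  assumes t: "truncated_doubling q d t" and s: "truncated_doubling q d s"
    and one: "\<And>y. t y = 1 \<Longrightarrow> s y = 1"
  shows "t y \<le> s y"
proof (rule ccontr)
  assume "\<not> t y \<le> s y"
  moreover have "0 \<le> s y" "t y \<le> 1"
    using s t by (simp_all add: truncated_doubling_def)
  ultimately obtain f where "\<forall>h x. truncated_doubling q d h \<longrightarrow>
      (t y \<le> h x \<longrightarrow> h (f x) = 1) \<and> (h x \<le> s y \<longrightarrow> h (f x) < 1)"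
    using separating_term[of "s y" "t y" q d] by auto
  with t s have "t (f y) = 1" "s (f y) < 1" by auto
  with one show False by fastforce
qed

text \<open>
  One application of \<open>d\<close> doubles the distance of a value to \<open>1\<close>, truncated at \<open>1\<close>.
\<close>

lemma iterated_d_value:
  assumes "truncated_doubling q d h"
  shows "h ((d ^^ n) y) = max 0 (1 - 2 ^ n * (1 - h y))"
proof (induction n)
  case 0
  then show ?case using assms by (simp add: truncated_doubling_def)
next
  case (Suc n)
  have "h ((d ^^ Suc n) y) = max 0 (2 * h ((d ^^ n) y) - 1)"
    using assms by (simp add: truncated_doubling_def trunc_mult_def)
  then show ?case unfolding Suc.IH by (auto simp: max_def algebra_simps)
qed

section \<open>Order and compactness\<close>

lemma (in effect_algebra) le_trans:
  assumes "x \<sqsubseteq> y" "y \<sqsubseteq> z"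
  shows "x \<sqsubseteq> z"
proof -
  from assms obtain a b where "padd x a = Some y" "padd y b = Some z"
    unfolding le_def by blast
  then have "padd a x = Some y" "padd b y = Some z" by (auto intro: E1)
  from E2[OF this] show ?thesis unfolding le_def using E1 by blast
qed

context q_effect_algebra
begin

lemma q_state_truncated_doubling: "q_state s \<Longrightarrow> truncated_doubling q d s"
  by (simp add: q_state_def truncated_doubling_def)

lemma q_semi_state_truncated_doubling: "q_semi_state t \<Longrightarrow> truncated_doubling q d t"
  by (simp add: q_semi_state_def truncated_doubling_def)

lemma q_state_mono:
  assumes "q_state s" "x \<sqsubseteq> y"
  shows "s x \<le> s y"
proof -
  from assms(2) obtain z where "padd x z = Some y" unfolding le_def by blast
  with assms(1) have "s y = s x + s z" "0 \<le> s z" by (auto simp: q_state_def)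
  then show ?thesis by simp
qed

text \<open>
  Every condition in the definition of a q-state is a closed condition on finitely many
  coordinates, so the q-states form a closed subset of the cube \<open>[0,1]\<^sup>E\<close>, which is compact by
  Tychonoff's theorem.
\<close>

lemma compact_q_states: "compact {s. q_state s}"
proof -
  have "compactin (product_topology (\<lambda>_::'a. euclidean) UNIV) (PiE UNIV (\<lambda>_. {0..1::real}))"
    by (simp add: compactin_PiE)
  then have cube: "compact (PiE UNIV (\<lambda>_::'a. {0..1::real}))"
    by (simp add: euclidean_product_topology)
  have additive: "closed {s :: 'a \<Rightarrow> real. padd x y = Some z \<longrightarrow> s z = s x + s y}" for x y z
    by (cases "padd x y = Some z")
       (auto intro!: closed_Collect_eq continuous_on_product_coordinates continuous_intros)
  have "closed {s. q_state s}"
    unfolding q_state_def trunc_add_def trunc_mult_def atLeastAtMost_iff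
    by (intro closed_Collect_conj closed_Collect_all additive closed_Collect_eq closed_Collect_le
        continuous_on_product_coordinates continuous_intros)
  moreover have "{s. q_state s} = PiE UNIV (\<lambda>_. {0..1}) \<inter> {s. q_state s}"
    by (auto simp: q_state_def)
  ultimately show ?thesis using cube by (metis compact_Int_closed)
qed

lemma Jauch_Piron_finite_lower_bound:
  assumes "Jauch_Piron_q_semi_state t" "finite A" "\<forall>w\<in>A. t w = 1"
  shows "\<exists>z. t z = 1 \<and> (\<forall>w\<in>A. z \<sqsubseteq> w)"
  using assms(2,3)
proof (induction A rule: finite_induct)
  case empty
  then show ?case
    using assms(1) by (auto simp: Jauch_Piron_q_semi_state_def q_semi_state_def)
next
  case (insert a A)
  then obtain z where z: "t z = 1" "\<forall>w\<in>A. z \<sqsubseteq> w" by auto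
  moreover have "t a = 1" using insert.prems by simp
  ultimately obtain z' where "t z' = 1" "z' \<sqsubseteq> z" "z' \<sqsubseteq> a"
    using assms(1) unfolding Jauch_Piron_q_semi_state_def by blast
  with z show ?case by (auto intro: le_trans)
qed

section \<open>States above a Jauch-Piron semi-state\<close>

text \<open>
  This is the compactness argument: were there no such state, some \<open>d z\<close> with \<open>t (d z) = 1\<close> would
  lie below a term in \<open>x\<close> whose value under \<open>t\<close> is less than \<open>1\<close>.
\<close>

lemma ex_q_state_above_with_small_value:
  assumes refl: "order_reflecting {s. q_state s}"
    and JP: "Jauch_Piron_q_semi_state t"
    and r: "t x < r" "r \<le> 1"
  shows "\<exists>s. q_state s \<and> (\<forall>y. t y \<le> s y) \<and> s x \<le> r"
proof (rule ccontr)
  assume none: "\<nexists>s. q_state s \<and> (\<forall>y. t y \<le> s y) \<and> s x \<le> r"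
  have semi: "q_semi_state t" using JP by (simp add: Jauch_Piron_q_semi_state_def)
  note td = q_semi_state_truncated_doubling[OF semi]
  define K where "K = {s. q_state s} \<inter> {s. s x \<le> r}"
  define U where "U w = {s :: 'a \<Rightarrow> real. s w < 1/2}" for w
  have "compact K"
    unfolding K_def
    by (intro compact_Int_closed compact_q_states closed_Collect_le
        continuous_on_product_coordinates continuous_intros)
  moreover have "open (U w)" for w
    unfolding U_def by (intro open_Collect_less continuous_on_product_coordinates continuous_intros)
  moreover have "K \<subseteq> (\<Union>w\<in>{w. t w = 1}. U w)"
  proof
    fix s assume "s \<in> K"
    then have s: "q_state s" "s x \<le> r" by (auto simp: K_def)
    note sd = q_state_truncated_doubling[OF s(1)]
    with none s le_if_one_on_unit_set[OF td sd] obtain y where y: "t y = 1" "s y \<noteq> 1"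
      by blast
    with sd have "s y < 1" by (auto simp: truncated_doubling_def less_le)
    moreover obtain n where "1 / (1 - s y) < 2 ^ n"
      using real_arch_pow[of 2 "1 / (1 - s y)"] by auto
    ultimately have "1 < 2 ^ n * (1 - s y)" by (simp add: field_simps)
    then have "s ((d ^^ n) y) = 0"
      using iterated_d_value[OF sd] by simp
    moreover have "t ((d ^^ n) y) = 1"
      using iterated_d_value[OF td] y by simp
    ultimately show "s \<in> (\<Union>w\<in>{w. t w = 1}. U w)" by (force simp: U_def)
  qed
  ultimately obtain A where A: "A \<subseteq> {w. t w = 1}" "finite A" "K \<subseteq> (\<Union>w\<in>A. U w)"
    by (rule compactE_image)
  then obtain z where z: "t z = 1" "\<forall>w\<in>A. z \<sqsubseteq> w"
    using Jauch_Piron_finite_lower_bound[OF JP, of A] by blast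
  have dz: "s (d z) = 0" if "s \<in> K" for s
  proof -
    from that A(3) obtain w where w: "w \<in> A" "s w < 1/2" by (auto simp: U_def)
    have "q_state s" using that by (simp add: K_def)
    moreover have "s z < 1/2"
      using q_state_mono[OF \<open>q_state s\<close>, of z w] z w by auto
    ultimately show ?thesis by (simp add: q_state_def trunc_mult_def)
  qed
  have "0 \<le> t x" using semi by (simp add: q_semi_state_def)
  with r obtain f where f: "\<forall>h y. truncated_doubling q d h \<longrightarrow>
      (r \<le> h y \<longrightarrow> h (f y) = 1) \<and> (h y \<le> t x \<longrightarrow> h (f y) < 1)"
    using separating_term[of "t x" r q d] by auto
  have "s (d z) \<le> s (f x)" if s: "q_state s" for s
  proof (cases "s x \<le> r")
    case True
    with s have "s (d z) = 0" by (intro dz) (simp add: K_def)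
    then show ?thesis using s by (simp add: q_state_def)
  next
    case False
    then have "s (f x) = 1" using f q_state_truncated_doubling[OF s] by auto
    moreover have "s (d z) \<le> 1" using s unfolding q_state_def atLeastAtMost_iff by blast
    ultimately show ?thesis by simp
  qed
  then have "d z \<sqsubseteq> f x" using refl by (simp add: order_reflecting_def)
  then have "t (d z) \<le> t (f x)" using semi by (simp add: q_semi_state_def)
  moreover have "t (d z) = 1" using td z by (simp add: truncated_doubling_def trunc_mult_def)
  moreover have "t (f x) < 1" using f td by blast
  ultimately show False by simp
qed

lemma Jauch_Piron_q_semi_state_eq_Inf:
  assumes refl: "order_reflecting {s. q_state s}"
    and JP: "Jauch_Piron_q_semi_state t"
  shows "t x = unit_Inf {s x | s. q_state s \<and> (\<forall>y. t y \<le> s y)}" (is "_ = unit_Inf ?A")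
proof -
  have t01: "t x \<le> 1"
    using JP by (simp add: Jauch_Piron_q_semi_state_def q_semi_state_def)
  have lower: "t x \<le> a" if "a \<in> ?A" for a using that by auto
  have upper: "a \<le> 1" if "a \<in> ?A" for a using that by (auto simp: q_state_def)
  have close: "\<exists>a\<in>?A. a \<le> r" if "t x < r" "r \<le> 1" for r
    using ex_q_state_above_with_small_value[OF refl JP that] by blast
  show ?thesis
  proof (cases "?A = {}")
    case True
    then have "\<not> t x < 1" using close[of 1] by blast
    then show ?thesis using t01 True by (simp add: unit_Inf_def)
  next
    case False
    have "Inf ?A = t x"
    proof (rule cInf_eq_non_empty[OF False])
      fix b assume b: "\<And>a. a \<in> ?A \<Longrightarrow> b \<le> a"
      then have b1: "b \<le> 1" using False upper by (meson ex_in_conv order_trans)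
      show "b \<le> t x"
      proof (rule ccontr)
        assume "\<not> b \<le> t x"
        then have "t x < (t x + b) / 2" "(t x + b) / 2 < b" by auto
        moreover from this b1 obtain a where "a \<in> ?A" "a \<le> (t x + b) / 2"
          using close[of "(t x + b) / 2"] by auto
        ultimately show False using b[of a] by linarith
      qed
    qed (rule lower)
    then show ?thesis unfolding unit_Inf_def using False by (simp only: if_False)
  qed
qed

end

theorem theorem1:
  fixes padd :: "'a \<Rightarrow> 'a \<Rightarrow> 'a option"
    and zero one :: 'a
    and q d :: "'a \<Rightarrow> 'a"
    and S S\<^sub>t :: "('a \<Rightarrow> real) set"
    and t :: "'a \<Rightarrow> real"
  assumes "q_effect_algebra padd zero one q d"
    and "S = {s. q_effect_algebra.q_state padd zero one q d s}"
    and "q_effect_algebra.order_reflecting padd S"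
    and "q_effect_algebra.Jauch_Piron_q_semi_state padd one q d t"
    and "S\<^sub>t = {s \<in> S. \<forall>x. t x \<le> s x}"
  shows "\<forall>x. t x = unit_Inf {s x | s. s \<in> S\<^sub>t}"
proof -
  interpret q_effect_algebra padd zero one q d by fact
  show ?thesis
    using Jauch_Piron_q_semi_state_eq_Inf assms(2-5) by simp
qed

end
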